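(* Let $\Delta t>0$ and $\nu=\alpha=0$, and let $\mathbf u_h^0\in V_h^{1,c}$ with $\operatorname{div}(\mathbf u_h^0)=0$. Let $(\mathbf u_h^{n})_{n\ge0}\subset V_h^{1,c}$ and $(p_h^{n})_{n\ge1}\subset V_h^{2,c}$ be such that for every $n\ge0$, with $\mathbf u_h^{n+\frac12}:=\frac12(\mathbf u_h^{n+1}+\mathbf u_h^n)$, the Crank--Nicolson system (with zero viscosity $\nu$ and zero stabilization $\alpha$) $$\int_\Omega\frac{\mathbf u_h^{n+1}-\mathbf u_h^n}{\Delta t}\cdot\mathbf v_h+\int_\Omega\mathbf u_h^{n+\frac12}\cdot s_h(\mathbf u_h^{n+\frac12},\mathbf v_h)+\int_\Omega\widetilde{\mathrm{grad}}_h\,p_h^{n+1}\cdot\mathbf v_h=0,$$ $$\int_\Omega\mathbf u_h^{n+\frac12}\cdot s_h(\mathbf u_h^{n+\frac12},\widetilde{\mathrm{grad}}_h\,q_h)+\int_\Omega\widetilde{\mathrm{grad}}_h\,p_h^{n+1}\cdot\widetilde{\mathrm{grad}}_h\,q_h=0$$ holds for all $\mathbf v_h\in V_h^{1,c}$ and $q_h\in V_h^{2,c}$. Then the kinetic energy is preserved: for all $n\ge0$, $$\frac1{\Delta t}\Big(\int_\Omega\tfrac12|\mathbf u_h^{n+1}|^2-\int_\Omega\tfrac12|\mathbf u_h^n|^2\Big)=0.$$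
   Context: Setting (dimension $d=2$). $\Omega$ is a two-dimensional domain with either periodic boundary conditions (a rectangle with opposite sides identified; all function spaces are spaces of periodic functions: $V^0=H^1(\Omega)$, $V^1=H(\mathrm{div};\Omega)$, $V^2=L^2(\Omega)$) or homogeneous boundary conditions on a bounded Lipschitz domain ($V^0=H^1_0(\Omega)$, $V^1=H_0(\mathrm{div};\Omega)$, $V^2=L^2(\Omega)$). For scalar $\omega$, $\operatorname{curl}\omega=(\partial_2\omega,-\partial_1\omega)$. Discrete spaces: $V_h^{\ell,c}\subset V^\ell$, $\ell=0,1,2$, are finite-dimensional (finite element) spaces of bounded functions with $\operatorname{curl}V_h^{0,c}\subset V_h^{1,c}$ and $\operatorname{div}V_h^{1,c}\subset V_h^{2,c}$. Discrete dual gradient: $\widetilde{\mathrm{grad}}_h:V_h^{2,c}\to V_h^{1,c}$ is defined by $\int_\Omega \widetilde{\mathrm{grad}}_h q_h\cdot\mathbf v_h=-\int_\Omega q_h\operatorname{div}\mathbf v_h$ for all $q_h\in V_h^{2,c}$, $\mathbf v_h\in V_h^{1,c}$. For $\mathbf a\in\mathbb R^2$, $\tilde\imath^{0h}_{\mathbf a}\mathbf u_h=\tilde P_h^0(\mathbf a\cdot\mathbf u_h)$, with $\tilde P_h^0$ the $L^2$-orthogonal projection onto $V_h^{2,c}$. With $\mathbf e_1,\mathbf e_2$ the canonical basis and $P_h^1$ the $L^2$-orthogonal projection onto $V_h^{1,c}$, $$s_h(\mathbf u_h,\mathbf v_h)=\tfrac12P_h^1\Big(\sum_{k=1}^{2}(\tilde\imath^{0h}_{\mathbf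 e_k}\mathbf v_h)\,\widetilde{\mathrm{grad}}_h(\tilde\imath^{0h}_{\mathbf e_k}\mathbf u_h)-(\tilde\imath^{0h}_{\mathbf e_k}\mathbf u_h)\,\widetilde{\mathrm{grad}}_h(\tilde\imath^{0h}_{\mathbf e_k}\mathbf v_h)\Big).$$ *)

theory Defs
  imports "HOL-Analysis.Analysis"
begin

text \<open>
  Elements of Lebesgue and Sobolev spaces are represented by functions on the whole plane, of which
  only the values almost everywhere on the domain matter.
\<close>

type_synonym scalar_field = "real^2 \<Rightarrow> real"
type_synonym vector_field = "real^2 \<Rightarrow> real^2"

text \<open>
  \<open>Periodic a b\<close> is the rectangle with lower left corner \<open>a\<close> and upper right corner \<open>b\<close>, opposite
  sides identified; \<open>Homogeneous U\<close> is the domain \<open>U\<close> with homogeneous boundary conditions.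
\<close>

datatype dom = Periodic "real^2" "real^2" | Homogeneous "(real^2) set"

fun region :: "dom \<Rightarrow> (real^2) set" where
  "region (Periodic a b) = box a b"
| "region (Homogeneous U) = U"

text \<open>
  After a rigid motion, near each boundary point the set is the part of a rectangle lying strictly
  above the graph of a Lipschitz function (which then automatically vanishes at 0).
\<close>

definition lipschitz_boundary :: "(real^2) set \<Rightarrow> bool" where
  "lipschitz_boundary U \<longleftrightarrow>
     (\<forall>p\<in>frontier U. \<exists>(T :: real^2 \<Rightarrow> real^2) (\<gamma> :: real \<Rightarrow> real) L r h.
        orthogonal_transformation T \<and> r > 0 \<and> h > 0 \<and> L-lipschitz_on {-r<..<r} \<gamma> \<and>
        (\<forall>y. \<bar>y $ 1\<bar> < r \<and> \<bar>y $ 2\<bar> < h \<longrightarrow> (p + T y \<in> U \<longleftrightarrow> \<gamma> (y $ 1) < y $ 2)))"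

fun valid_dom :: "dom \<Rightarrow> bool" where
  "valid_dom (Periodic a b) \<longleftrightarrow> (\<forall>i. a $ i < b $ i)"
| "valid_dom (Homogeneous U) \<longleftrightarrow>
     U \<noteq> {} \<and> open U \<and> connected U \<and> bounded U \<and> lipschitz_boundary U"

fun periodic_if :: "dom \<Rightarrow> (real^2 \<Rightarrow> 'b) \<Rightarrow> bool" where
  "periodic_if (Periodic a b) f \<longleftrightarrow> (\<forall>x i. f (x + axis i (b $ i - a $ i)) = f x)"
| "periodic_if (Homogeneous U) f \<longleftrightarrow> True"

definition partial :: "2 \<Rightarrow> scalar_field \<Rightarrow> scalar_field" where
  "partial i \<phi> x = frechet_derivative \<phi> (at x) (axis i 1)"

fun times_differentiable :: "nat \<Rightarrow> scalar_field \<Rightarrow> bool" where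
  "times_differentiable 0 \<phi> \<longleftrightarrow> True"
| "times_differentiable (Suc k) \<phi> \<longleftrightarrow>
     (\<forall>x. \<phi> differentiable (at x)) \<and> (\<forall>i. times_differentiable k (partial i \<phi>))"

definition smooth :: "scalar_field \<Rightarrow> bool" where
  "smooth \<phi> \<longleftrightarrow> (\<forall>k. times_differentiable k \<phi>)"

fun test_function :: "dom \<Rightarrow> scalar_field \<Rightarrow> bool" where
  "test_function (Periodic a b) \<phi> \<longleftrightarrow> smooth \<phi> \<and> periodic_if (Periodic a b) \<phi>"
| "test_function (Homogeneous U) \<phi> \<longleftrightarrow>
     smooth \<phi> \<and> (\<exists>K. compact K \<and> K \<subseteq> U \<and> (\<forall>x. x \<notin> K \<longrightarrow> \<phi> x = 0))"

definition grad :: "scalar_field \<Rightarrow> vector_field" where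
  "grad \<phi> x = (\<chi> i. partial i \<phi> x)"

definition classical_div :: "vector_field \<Rightarrow> scalar_field" where
  "classical_div \<psi> x = (\<Sum>i\<in>UNIV. partial i (\<lambda>y. \<psi> y $ i) x)"

definition integ :: "dom \<Rightarrow> scalar_field \<Rightarrow> real" where
  "integ D f = integral\<^sup>L (lebesgue_on (region D)) f"

definition L2 :: "dom \<Rightarrow> (real^2 \<Rightarrow> 'b::euclidean_space) set" where
  "L2 D = {f. f \<in> borel_measurable (lebesgue_on (region D)) \<and>
              integrable (lebesgue_on (region D)) (\<lambda>x. (norm (f x))\<^sup>2) \<and> periodic_if D f}"

definition L2_tendsto ::
    "dom \<Rightarrow> (nat \<Rightarrow> real^2 \<Rightarrow> 'b::euclidean_space) \<Rightarrow> (real^2 \<Rightarrow> 'b) \<Rightarrow> bool" where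
  "L2_tendsto D f g \<longleftrightarrow> (\<lambda>n. integ D (\<lambda>x. (norm (f n x - g x))\<^sup>2)) \<longlonglongrightarrow> 0"

definition has_weak_grad :: "dom \<Rightarrow> scalar_field \<Rightarrow> vector_field \<Rightarrow> bool" where
  "has_weak_grad D \<omega> g \<longleftrightarrow> g \<in> L2 D \<and>
     (\<forall>\<phi> i. test_function D \<phi> \<longrightarrow>
        integ D (\<lambda>x. \<omega> x * partial i \<phi> x) = - integ D (\<lambda>x. g x $ i * \<phi> x))"

definition has_weak_curl :: "dom \<Rightarrow> scalar_field \<Rightarrow> vector_field \<Rightarrow> bool" where
  "has_weak_curl D \<omega> w \<longleftrightarrow>
     (\<exists>g. has_weak_grad D \<omega> g \<and> (\<forall>x. w x = vector [g x $ 2, - (g x $ 1)]))"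

definition has_weak_div :: "dom \<Rightarrow> vector_field \<Rightarrow> scalar_field \<Rightarrow> bool" where
  "has_weak_div D v d \<longleftrightarrow> d \<in> L2 D \<and>
     (\<forall>\<phi>. test_function D \<phi> \<longrightarrow> integ D (\<lambda>x. v x \<bullet> grad \<phi> x) = - integ D (\<lambda>x. d x * \<phi> x))"

text \<open>The weak divergence is unique up to null sets; a representative is chosen.\<close>

definition weak_div :: "dom \<Rightarrow> vector_field \<Rightarrow> scalar_field" where
  "weak_div D v = (SOME d. has_weak_div D v d)"

text \<open>
  For homogeneous boundary conditions, the spaces \<open>H\<^sup>1\<^sub>0\<close> and \<open>H\<^sub>0(div)\<close> are the closures of the smooth
  compactly supported fields in the graph norms.
\<close>

fun V0 :: "dom \<Rightarrow> scalar_field set" where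
  "V0 (Periodic a b) = {\<omega> \<in> L2 (Periodic a b). \<exists>g. has_weak_grad (Periodic a b) \<omega> g}"
| "V0 (Homogeneous U) = {\<omega> \<in> L2 (Homogeneous U). \<exists>g. has_weak_grad (Homogeneous U) \<omega> g \<and>
     (\<exists>\<phi>. (\<forall>n. test_function (Homogeneous U) (\<phi> n)) \<and>
          L2_tendsto (Homogeneous U) \<phi> \<omega> \<and>
          L2_tendsto (Homogeneous U) (\<lambda>n. grad (\<phi> n)) g)}"

fun V1 :: "dom \<Rightarrow> vector_field set" where
  "V1 (Periodic a b) = {v \<in> L2 (Periodic a b). \<exists>d. has_weak_div (Periodic a b) v d}"
| "V1 (Homogeneous U) = {v \<in> L2 (Homogeneous U). \<exists>d. has_weak_div (Homogeneous U) v d \<and>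
     (\<exists>\<psi>. (\<forall>n i. test_function (Homogeneous U) (\<lambda>x. \<psi> n x $ i)) \<and>
          L2_tendsto (Homogeneous U) \<psi> v \<and>
          L2_tendsto (Homogeneous U) (\<lambda>n. classical_div (\<psi> n)) d)}"

definition V2 :: "dom \<Rightarrow> scalar_field set" where
  "V2 D = L2 D"

definition ess_bounded :: "dom \<Rightarrow> (real^2 \<Rightarrow> 'b::euclidean_space) \<Rightarrow> bool" where
  "ess_bounded D f \<longleftrightarrow> (\<exists>C. AE x in lebesgue_on (region D). norm (f x) \<le> C)"

text \<open>Finite dimension is understood modulo equality almost everywhere.\<close>

definition discrete_space :: "dom \<Rightarrow> (real^2 \<Rightarrow> 'b::euclidean_space) set \<Rightarrow> bool" where
  "discrete_space D W \<longleftrightarrow>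
     (\<lambda>x. 0) \<in> W \<and>
     (\<forall>f\<in>W. \<forall>g\<in>W. (\<lambda>x. f x + g x) \<in> W) \<and>
     (\<forall>c. \<forall>f\<in>W. (\<lambda>x. c *\<^sub>R f x) \<in> W) \<and>
     (\<exists>B. finite B \<and> B \<subseteq> W \<and>
        (\<forall>f\<in>W. \<exists>c. AE x in lebesgue_on (region D). f x = (\<Sum>b\<in>B. c b *\<^sub>R b x))) \<and>
     (\<forall>f\<in>W. ess_bounded D f)"

definition discrete_complex ::
    "dom \<Rightarrow> scalar_field set \<Rightarrow> vector_field set \<Rightarrow> scalar_field set \<Rightarrow> bool" where
  "discrete_complex D V0h V1h V2h \<longleftrightarrow>
     discrete_space D V0h \<and> discrete_space D V1h \<and> discrete_space D V2h \<and>
     V0h \<subseteq> V0 D \<and> V1h \<subseteq> V1 D \<and> V2h \<subseteq> V2 D \<and>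
     (\<forall>\<omega>\<in>V0h. \<exists>w\<in>V1h. has_weak_curl D \<omega> w) \<and>
     (\<forall>v\<in>V1h. \<exists>d\<in>V2h. has_weak_div D v d)"

text \<open>As elements of \<open>L\<^sup>2\<close> the following are uniquely determined; a representative is chosen.\<close>

definition L2_proj ::
    "dom \<Rightarrow> (real^2 \<Rightarrow> 'b::euclidean_space) set \<Rightarrow> (real^2 \<Rightarrow> 'b) \<Rightarrow> (real^2 \<Rightarrow> 'b)" where
  "L2_proj D W f = (SOME w. w \<in> W \<and> (\<forall>z\<in>W. integ D (\<lambda>x. (f x - w x) \<bullet> z x) = 0))"

definition dual_grad ::
    "dom \<Rightarrow> vector_field set \<Rightarrow> scalar_field \<Rightarrow> vector_field" where
  "dual_grad D V1h q = (SOME w. w \<in> V1h \<and>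
     (\<forall>v\<in>V1h. integ D (\<lambda>x. w x \<bullet> v x) = - integ D (\<lambda>x. q x * weak_div D v x)))"

definition contraction ::
    "dom \<Rightarrow> scalar_field set \<Rightarrow> real^2 \<Rightarrow> vector_field \<Rightarrow> scalar_field" where
  "contraction D V2h a u = L2_proj D V2h (\<lambda>x. a \<bullet> u x)"

definition s_h ::
    "dom \<Rightarrow> vector_field set \<Rightarrow> scalar_field set \<Rightarrow> vector_field \<Rightarrow> vector_field \<Rightarrow> vector_field" where
  "s_h D V1h V2h u v = (\<lambda>x. (1/2) *\<^sub>R L2_proj D V1h (\<lambda>y. \<Sum>k\<in>(UNIV :: 2 set).
     contraction D V2h (axis k 1) v y *\<^sub>R dual_grad D V1h (contraction D V2h (axis k 1) u) y
     - contraction D V2h (axis k 1) u y *\<^sub>R dual_grad D V1h (contraction D V2h (axis k 1) v) y) x)"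

definition midpoint_field :: "(nat \<Rightarrow> vector_field) \<Rightarrow> nat \<Rightarrow> vector_field" where
  "midpoint_field u n x = (1/2) *\<^sub>R (u (Suc n) x + u n x)"

definition crank_nicolson_step ::
    "dom \<Rightarrow> vector_field set \<Rightarrow> scalar_field set \<Rightarrow> real \<Rightarrow>
     (nat \<Rightarrow> vector_field) \<Rightarrow> (nat \<Rightarrow> scalar_field) \<Rightarrow> nat \<Rightarrow> bool" where
  "crank_nicolson_step D V1h V2h \<Delta>t u p n \<longleftrightarrow>
     (\<forall>v\<in>V1h.
        integ D (\<lambda>x. ((1/\<Delta>t) *\<^sub>R (u (Suc n) x - u n x)) \<bullet> v x)
        + integ D (\<lambda>x. midpoint_field u n x \<bullet> s_h D V1h V2h (midpoint_field u n) v x)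
        + integ D (\<lambda>x. dual_grad D V1h (p (Suc n)) x \<bullet> v x) = 0) \<and>
     (\<forall>q\<in>V2h.
        integ D (\<lambda>x. midpoint_field u n x
                       \<bullet> s_h D V1h V2h (midpoint_field u n) (dual_grad D V1h q) x)
        + integ D (\<lambda>x. dual_grad D V1h (p (Suc n)) x \<bullet> dual_grad D V1h q x) = 0)"

end

theory Submission
  imports Defs
begin

text \<open>
  Testing the momentum equation with \<open>dual_grad q\<close> and subtracting the pressure equation shows that
  orthogonality of \<open>u n\<close> to all discrete gradients propagates from \<open>n\<close> to \<open>n + 1\<close>; it holds at \<open>n = 0\<close>
  because \<open>div (u 0) = 0\<close>. Testing with the midpoint field then gives the energy balance: the pressure
  term vanishes by this orthogonality and the transport term because \<open>s_h\<close> is antisymmetric.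

  The chosen representatives carry these properties only if they exist. For \<open>dual_grad\<close> this is the
  Riesz representation of \<open>v \<mapsto> - \<integral> q div v\<close>, whose linearity rests on the uniqueness of the weak
  divergence, i.e. on the fundamental lemma of the calculus of variations: smooth bumps converge
  boundedly to the indicator of any open box in the domain, and boxes generate the Borel sets.
\<close>

section \<open>Functions determined by their integrals over boxes\<close>

text \<open>Dynkin's pi-lambda argument: open boxes form an intersection-stable generator of the
  Borel sets, and \<open>total\<close> supplies the step to complements. A function whose integral
  over every Borel set is 0 vanishes almost everywhere.\<close>

lemma AE_zero_if_box_integrals_zero:
  fixes f :: "'a::euclidean_space \<Rightarrow> real"
  assumes f: "integrable lborel f"
    and total: "(LINT x|lborel. f x) = 0"
    and box: "\<And>a b. (LINT x:box a b|lborel. f x) = 0"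
  shows "AE x in lborel. f x = 0"
proof -
  have si: "set_integrable lborel A f" if "A \<in> sets borel" for A
    using integrable_mult_indicator[of A lborel f] f that by (simp add: set_integrable_def)
  have "(LINT x:A|lborel. f x) = 0" if "A \<in> sets borel" for A
  proof -
    let ?G = "range (\<lambda>(a, b). box a b :: 'a set)"
    have "Int_stable ?G"
      by (rule Int_stableI) (force simp: box_Int_box)
    moreover have "?G \<subseteq> Pow UNIV" by simp
    moreover have "A \<in> sigma_sets UNIV ?G"
      using that by (subst (asm) borel_eq_box) simp
    ultimately show ?thesis
    proof (induction rule: sigma_sets_induct_disjoint)
      case (basic A)
      then show ?case using box by auto
    next
      case empty
      then show ?case by (simp add: set_lebesgue_integral_def)
    next
      case (compl A)
      then have A: "A \<in> sets borel" by (subst borel_eq_box) simp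
      have "(LINT x:A \<union> (UNIV - A)|lborel. f x)
          = (LINT x:A|lborel. f x) + (LINT x:UNIV - A|lborel. f x)"
        using A by (intro set_integral_Un si) auto
      moreover have "A \<union> (UNIV - A) = UNIV" by auto
      ultimately show ?case using compl total by (simp add: set_lebesgue_integral_def)
    next
      case (union A)
      then have A: "A i \<in> sets borel" for i by (subst borel_eq_box) auto
      have "(LINT x:(\<Union>i. A i)|lborel. f x) = (\<Sum>i. (LINT x:(A i)|lborel. f x))"
        using A union(1) by (intro lebesgue_integral_countable_add si) (auto simp: disjoint_family_on_def)
      then show ?case using union by simp
    qed
  qed
  then show ?thesis
    using f by (intro density_unique_real) (auto simp: set_lebesgue_integral_def)
qed

text \<open>Localises the previous lemma: only boxes inside \<open>U\<close> are tested, so the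
  function is cut off to one such box at a time, and countably many of these boxes cover
  \<open>U\<close>.\<close>

lemma AE_zero_if_box_integrals_zero_on:
  fixes f :: "'a::euclidean_space \<Rightarrow> real"
  assumes U: "open U" and f: "integrable (lebesgue_on U) f"
    and box: "\<And>a b. box a b \<subseteq> U \<Longrightarrow> (LINT x|lebesgue_on U. f x * indicator (box a b) x) = 0"
  shows "AE x in lebesgue_on U. f x = 0"
proof -
  define g where "g x = indicator U x * f x" for x
  have Us: "U \<in> sets lebesgue" using U by auto
  have g: "integrable lebesgue g"
    using f Us unfolding g_def
    by (subst (asm) integrable_restrict_space) auto
  have int_g: "(LINT x|lebesgue. g x * indicator (box a b) x) = 0" if "box a b \<subseteq> U" for a b
  proof -
    have "(LINT x|lebesgue_on U. f x * indicator (box a b) x)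
        = (LINT x|lebesgue. indicator U x *\<^sub>R (f x * indicator (box a b) x))"
      using Us by (subst integral_restrict_space) auto
    then show ?thesis using box[OF that] by (simp add: g_def mult.assoc)
  qed
  \<comment> \<open>The box lemma speaks of \<open>lborel\<close>, while \<open>g\<close> is only
    Lebesgue measurable; it is exchanged for an almost everywhere equal Borel function.\<close>
  obtain g' where g'[measurable]: "g' \<in> borel_measurable lborel" and ae: "AE x in lborel. g x = g' x"
    using completion_ex_borel_measurable_real[OF borel_measurable_integrable[OF g]] by auto
  have ae': "AE x in lebesgue. g x = g' x"
    using ae by (rule AE_completion)
  have meas[measurable]: "g \<in> borel_measurable lebesgue" "g' \<in> borel_measurable lebesgue"
    using g measurable_completion[OF g'] by auto
  have g'_int: "integrable lborel g'"
  proof -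
    have "integrable lebesgue g'"
      using integrable_cong_AE[OF meas ae'] g by simp
    then show ?thesis by (simp add: integrable_completion)
  qed
  have int_g': "(LINT x:box a b|lborel. g' x) = 0" if "box a b \<subseteq> U" for a b
  proof -
    have "(LINT x:box a b|lborel. g' x) = (LINT x|lebesgue. g' x * indicator (box a b) x)"
      by (subst integral_completion) (auto simp: set_lebesgue_integral_def mult.commute)
    also have "\<dots> = (LINT x|lebesgue. g x * indicator (box a b) x)"
    proof (rule integral_cong_AE)
      have [measurable]: "box a b \<in> sets lebesgue" by simp
      show "(\<lambda>x. g x * indicator (box a b) x) \<in> borel_measurable lebesgue"
        "(\<lambda>x. g' x * indicator (box a b) x) \<in> borel_measurable lebesgue"
        by measurable
    qed (use ae' in auto)
    finally show ?thesis using int_g[OF that] by simp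
  qed
  \<comment> \<open>After the cutoff, an integral over any box is an integral of \<open>g'\<close>
    over its intersection with \<open>box a b\<close>, which is again a box inside
    \<open>U\<close>.\<close>
  have local: "AE x in lborel. x \<in> box a b \<longrightarrow> g' x = 0" if "box a b \<subseteq> U" for a b
  proof -
    have "AE x in lborel. indicator (box a b) x * g' x = 0"
    proof (rule AE_zero_if_box_integrals_zero)
      show "integrable lborel (\<lambda>x. indicator (box a b) x * g' x)"
        using integrable_mult_indicator[of "box a b" lborel g'] g'_int by simp
      show "(LINT x|lborel. indicator (box a b) x * g' x) = 0"
        using int_g'[OF that] by (simp add: set_lebesgue_integral_def)
      fix c d
      obtain p q where pq: "box c d \<inter> box a b = box p q" by (auto simp: box_Int_box)
      have "(LINT x:box c d|lborel. indicator (box a b) x * g' x) = (LINT x:box p q|lborel. g' x)"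
        unfolding set_lebesgue_integral_def pq[symmetric]
        by (rule Bochner_Integration.integral_cong) (auto simp: indicator_def)
      also have "\<dots> = 0" using pq that by (intro int_g') auto
      finally show "(LINT x:box c d|lborel. indicator (box a b) x * g' x) = 0" .
    qed
    then show ?thesis by eventually_elim (auto simp: indicator_def)
  qed
  obtain \<D> where \<D>: "countable \<D>" "\<D> \<subseteq> Pow U" "\<And>X. X \<in> \<D> \<Longrightarrow> \<exists>a b. X = box a b" "\<Union>\<D> = U"
    using open_countable_Union_open_box[OF U] by metis
  have "AE x in lborel. \<forall>X\<in>\<D>. x \<in> X \<longrightarrow> g' x = 0"
    using \<D> local by (intro AE_ball_countable[THEN iffD2]) (auto, blast)
  with ae have "AE x in lborel. x \<in> U \<longrightarrow> f x = 0"
  proof eventually_elim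
    case (elim x)
    have "g' x = 0" if "x \<in> U" using elim(2) that \<D>(4) by blast
    with elim(1) show ?case by (auto simp: g_def)
  qed
  then have "AE x in lebesgue. x \<in> U \<longrightarrow> f x = 0" by (rule AE_completion)
  then show ?thesis using Us by (simp add: AE_restrict_space_iff)
qed

section \<open>Test functions approximating indicators of boxes\<close>

text \<open>\<open>flat 0\<close> is the classical smooth function that is zero on the negative
  half-line. The powers of \<open>1/t\<close> make linear combinations of the family closed under
  differentiation.\<close>

definition flat :: "nat \<Rightarrow> real \<Rightarrow> real" where
  "flat k t = (if t > 0 then (1/t)^k * exp (- (1/t)) else 0)"

text \<open>From the right, substitute the reciprocal: the exponential outgrows every power.\<close>

lemma tendsto_flat_0: "(flat k \<longlongrightarrow> 0) (at 0)"
proof -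
  have "((\<lambda>t::real. inverse t ^ k / exp (inverse t)) \<longlongrightarrow> 0) (at_right 0)"
    by (rule filterlim_compose[OF tendsto_power_div_exp_0 filterlim_inverse_at_top_right])
  then have "(flat k \<longlongrightarrow> 0) (at_right 0)"
    by (rule Lim_transform_eventually)
       (auto simp: flat_def eventually_at_filter exp_minus field_simps)
  moreover have "(flat k \<longlongrightarrow> 0) (at_left 0)"
    by (rule Lim_transform_eventually[OF tendsto_const])
       (auto simp: flat_def eventually_at_filter)
  ultimately show ?thesis by (simp add: filterlim_split_at)
qed

lemma flat_has_derivative:
  "(flat k has_real_derivative flat (k + 2) t - real k * flat (k + 1) t) (at t)"
proof -
  consider "t > 0" | "t < 0" | "t = 0" by linarith
  then show ?thesis
  proof cases
    case 1
    have "((\<lambda>t. (1/t)^k * exp (- (1/t))) has_real_derivative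
        flat (k + 2) t - real k * flat (k + 1) t) (at t)"
      \<comment> \<open>The power rule produces the exponent \<open>k - 1\<close> in truncated
        subtraction, hence the case splits.\<close>
      using 1 by (auto intro!: derivative_eq_intros simp: flat_def divide_simps)
        (cases k; cases "k - 1"; simp add: algebra_simps)
    moreover have "eventually (\<lambda>s. s \<in> {0<..}) (nhds t)"
      using 1 by (intro eventually_nhds_in_open) auto
    then have "eventually (\<lambda>s. flat k s = (1/s)^k * exp (- (1/s))) (nhds t)"
      by eventually_elim (auto simp: flat_def)
    ultimately show ?thesis by (subst DERIV_cong_ev[OF refl _ refl]) auto
  next
    case 2
    have "eventually (\<lambda>s. s \<in> {..<0}) (nhds t)"
      using 2 by (intro eventually_nhds_in_open) auto
    then have "eventually (\<lambda>s. flat k s = 0) (nhds t)"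
      by eventually_elim (auto simp: flat_def)
    then show ?thesis using 2 by (subst DERIV_cong_ev[OF refl _ refl]) (auto simp: flat_def)
  next
    case 3
    \<comment> \<open>Away from 0 the difference quotient at 0 is \<open>flat (k + 1) h\<close>
      itself.\<close>
    have "((\<lambda>h. (flat k h - flat k 0) / h) \<longlongrightarrow> 0) (at 0)"
      by (rule Lim_transform_eventually[OF tendsto_flat_0[of "k + 1"]])
         (auto simp: flat_def eventually_at_filter)
    then show ?thesis using 3 by (simp add: DERIV_def flat_def)
  qed
qed

lemma flat_0_bounds: "0 \<le> flat 0 t" "flat 0 t \<le> 1"
  by (auto simp: flat_def)

text \<open>For \<open>s > 0\<close> the argument tends to infinity, where \<open>flat 0\<close>
  tends to 1; otherwise it is at most -1, where \<open>flat 0\<close> is zero.\<close>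

lemma flat_0_tendsto:
  "(\<lambda>n. flat 0 (real n * s - 1)) \<longlonglongrightarrow> (if s > 0 then 1 else 0)"
proof (cases "s > 0")
  case True
  have lim: "filterlim (\<lambda>n. real n * s - 1) at_top sequentially"
    using True by real_asymp
  have "(\<lambda>n. exp (- inverse (real n * s - 1))) \<longlonglongrightarrow> exp (- 0)"
    by (intro tendsto_intros tendsto_inverse_0_at_top lim)
  moreover have "eventually (\<lambda>n. real n * s - 1 > 0) sequentially"
    using lim unfolding filterlim_at_top_dense by blast
  then have "eventually (\<lambda>n. exp (- inverse (real n * s - 1)) = flat 0 (real n * s - 1)) sequentially"
    by eventually_elim (auto simp: flat_def inverse_eq_divide)
  ultimately show ?thesis using True by (auto intro: Lim_transform_eventually)
next
  case False
  then have "real n * s \<le> 0" for n by (auto simp: mult_nonneg_nonpos)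
  then have "flat 0 (real n * s - 1) = 0" for n
    using order.strict_trans1[of "real n * s" 0 1] by (auto simp: flat_def not_less intro: order.trans)
  then show ?thesis using False by simp
qed

section \<open>A class of smooth functions closed under differentiation\<close>

inductive elementary :: "scalar_field \<Rightarrow> bool" where
  const: "elementary (\<lambda>x. c)"
| coord: "elementary (\<lambda>x. x $ i)"
| add: "elementary f \<Longrightarrow> elementary g \<Longrightarrow> elementary (\<lambda>x. f x + g x)"
| mult: "elementary f \<Longrightarrow> elementary g \<Longrightarrow> elementary (\<lambda>x. f x * g x)"
| sin: "elementary f \<Longrightarrow> elementary (\<lambda>x. sin (f x))"
| flat: "elementary f \<Longrightarrow> elementary (\<lambda>x. flat k (f x))"

lemma has_derivative_partial:
  assumes "(\<phi> has_derivative \<phi>') (at x)"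
  shows "partial i \<phi> x = \<phi>' (axis i 1)"
  using frechet_derivative_at[OF assms] by (simp add: partial_def)

text \<open>Smoothness is proved by induction on the order of differentiation, so the derivative in
  each fixed direction must lie in the class again.\<close>

lemma elementary_deriv:
  "elementary f \<Longrightarrow> \<exists>f'. (\<forall>x. (f has_derivative f' x) (at x)) \<and> (\<forall>v. elementary (\<lambda>x. f' x v))"
proof (induction rule: elementary.induct)
  case (const c)
  then show ?case
    by (intro exI[of _ "\<lambda>x v. 0"]) (auto intro: elementary.const)
next
  case (coord i)
  then show ?case
    by (intro exI[of _ "\<lambda>x v. v $ i"])
       (auto intro: elementary.const bounded_linear_imp_has_derivative bounded_linear_vec_nth)
next
  case (add f g)
  then obtain f' g' where "\<forall>x. (f has_derivative f' x) (at x)" "\<forall>v. elementary (\<lambda>x. f' x v)"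
    "\<forall>x. (g has_derivative g' x) (at x)" "\<forall>v. elementary (\<lambda>x. g' x v)" by blast
  then show ?case
    by (intro exI[of _ "\<lambda>x v. f' x v + g' x v"]) (auto intro: elementary.add has_derivative_add)
next
  case (mult f g)
  then obtain f' g' where "\<forall>x. (f has_derivative f' x) (at x)" "\<forall>v. elementary (\<lambda>x. f' x v)"
    "\<forall>x. (g has_derivative g' x) (at x)" "\<forall>v. elementary (\<lambda>x. g' x v)" by blast
  with mult show ?case
    by (intro exI[of _ "\<lambda>x v. f x * g' x v + f' x v * g x"])
       (auto intro!: elementary.add elementary.mult has_derivative_mult)
next
  case (sin f)
  then obtain f' where f': "\<forall>x. (f has_derivative f' x) (at x)" "\<forall>v. elementary (\<lambda>x. f' x v)" by blast
  \<comment> \<open>The cosine is written as a shifted sine, which keeps the derivative within the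
    constructors of the class.\<close>
  have "((\<lambda>x. sin (f x)) has_derivative (\<lambda>v. sin (f x + pi/2) * f' x v)) (at x)" for x
    using f'(1) by (auto intro!: derivative_eq_intros simp: sin_add)
  then show ?case using sin(1) f'(2)
    by (intro exI[of _ "\<lambda>x v. sin (f x + pi/2) * f' x v"])
       (auto intro!: elementary.intros)
next
  case (flat f k)
  then obtain f' where f': "\<forall>x. (f has_derivative f' x) (at x)" "\<forall>v. elementary (\<lambda>x. f' x v)" by blast
  let ?d = "\<lambda>t. flat (k + 2) t + (- real k) * flat (k + 1) t"
  have "((\<lambda>x. flat k (f x)) has_derivative (\<lambda>v. ?d (f x) * f' x v)) (at x)" for x
  proof -
    have "(flat k has_derivative (*) (?d (f x))) (at (f x))"
      using flat_has_derivative[of k "f x"] by (simp add: has_field_derivative_def)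
    from has_derivative_compose[OF f'(1)[rule_format] this] show ?thesis by simp
  qed
  then show ?case using flat(1) f'(2)
    by (intro exI[of _ "\<lambda>x v. ?d (f x) * f' x v"])
       (intro conjI allI elementary.add elementary.mult elementary.const elementary.flat; blast)
qed

lemma elementary_smooth:
  assumes "elementary f"
  shows "smooth f"
proof -
  have "times_differentiable k f" for k
    using assms
  proof (induction k arbitrary: f)
    case (Suc k)
    obtain f' where f': "\<And>x. (f has_derivative f' x) (at x)" "\<And>v. elementary (\<lambda>x. f' x v)"
      using elementary_deriv[OF Suc.prems] by blast
    have "partial i f = (\<lambda>x. f' x (axis i 1))" for i
      using has_derivative_partial[OF f'(1)] by auto
    then show ?case using f' Suc.IH by (auto simp: differentiable_def)
  qed simp
  then show ?thesis by (simp add: smooth_def)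
qed

lemma elementary_minus:
  assumes "elementary f" "elementary g"
  shows "elementary (\<lambda>x. f x - g x)"
  using elementary.add[OF assms(1) elementary.mult[OF elementary.const[of "-1"] assms(2)]] by simp

lemma elementary_prod:
  assumes "\<And>i. i \<in> I \<Longrightarrow> elementary (f i)"
  shows "elementary (\<lambda>x. \<Prod>i\<in>I. f i x)"
  using assms
  by (induction I rule: infinite_finite_induct) (auto intro: elementary.intros)

text \<open>
  The shift by \<open>-1\<close> confines the support to \<open>{x. \<forall>i. n * s i (x $ i) \<ge> 1}\<close>, which is compact when the
  set where all \<open>s i\<close> are positive is a bounded open box.
\<close>

definition bump :: "(2 \<Rightarrow> real \<Rightarrow> real) \<Rightarrow> nat \<Rightarrow> scalar_field" where
  "bump s n x = (\<Prod>i\<in>UNIV. flat 0 (real n * s i (x $ i) - 1))"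

lemma bump_smooth:
  assumes "\<And>i. elementary (\<lambda>x. s i (x $ i))"
  shows "smooth (bump s n)"
proof -
  have "elementary (\<lambda>x. bump s n x)"
    unfolding bump_def using assms
    by (intro elementary_prod elementary.flat elementary_minus elementary.mult elementary.const) auto
  then show ?thesis by (intro elementary_smooth) simp
qed

lemma bump_bound: "\<bar>bump s n x\<bar> \<le> 1"
  unfolding bump_def abs_prod by (rule prod_le_1) (auto simp: flat_0_bounds)

lemma bump_tendsto: "(\<lambda>n. bump s n x) \<longlonglongrightarrow> (if \<forall>i. s i (x $ i) > 0 then 1 else 0)"
proof -
  have "(\<lambda>n. bump s n x) \<longlonglongrightarrow> (\<Prod>i\<in>UNIV. if s i (x $ i) > 0 then 1 else 0)"
    unfolding bump_def by (intro tendsto_prod flat_0_tendsto)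
  also have "(\<Prod>i\<in>UNIV. if s i (x $ i) > 0 then 1 else 0) = (if \<forall>i. s i (x $ i) > 0 then 1 else (0::real))"
    by (auto simp: prod_zero_iff)
  finally show ?thesis .
qed

lemma bump_nonzero:
  assumes "bump s n x \<noteq> 0"
  shows "real n * s i (x $ i) > 1"
  using assms by (auto simp: bump_def flat_def split: if_splits)

text \<open>It suffices to find one-dimensional profiles \<open>s i\<close> that are positive in the
  domain exactly between \<open>c $ i\<close> and \<open>e $ i\<close>; their bumps then converge as
  required. The profile must be compatible with the boundary conditions.\<close>

lemma test_function_indicator_box:
  assumes D: "valid_dom D" and box: "box c e \<subseteq> region D"
  obtains \<phi> where "\<And>n. test_function D (\<phi> n)" "\<And>n x. \<bar>\<phi> n x\<bar> \<le> 1"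
    "\<And>x. x \<in> region D \<Longrightarrow> (\<lambda>n. \<phi> n x) \<longlonglongrightarrow> indicator (box c e) x"
proof (cases "box c e = {}")
  \<comment> \<open>The sign analysis of the profiles uses \<open>c $ i < e $ i\<close>, so the
    empty box is served by the zero function.\<close>
  case True
  have "elementary (\<lambda>x. 0)" by (rule elementary.const)
  then have "test_function D (\<lambda>x. 0)"
    by (cases D) (auto intro: elementary_smooth exI[of _ "{}"])
  then show ?thesis using True by (intro that[of "\<lambda>n x. 0"]) auto
next
  case False
  then have ce: "c $ i < e $ i" for i using interval_ne_empty_cart(2)[of c e] by auto
  have ex: "\<exists>s. (\<forall>i. elementary (\<lambda>x. s i (x $ i))) \<and> (\<forall>n. test_function D (bump s n)) \<and>
    (\<forall>x\<in>region D. (\<forall>i. s i (x $ i) > 0) \<longleftrightarrow> x \<in> box c e)"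
  proof (cases D)
    case (Periodic a b)
    have ab: "a $ i < b $ i" for i using D Periodic by auto
    have "box c e \<subseteq> box a b" using box Periodic by simp
    then have "\<forall>i. a $ i \<le> c $ i \<and> e $ i \<le> b $ i"
      using subset_interval_cart(4)[of c e a b] ce by auto
    then have sub: "a $ i \<le> c $ i" "e $ i \<le> b $ i" for i by auto
    \<comment> \<open>With this frequency, a shift by one period moves the argument of each sine by
      \<open>pi\<close> up to sign; both factors of \<open>s\<close> change sign and their product
      is periodic.\<close>
    define w where "w i = pi / (b $ i - a $ i)" for i
    have w: "w i > 0" "w i * (b $ i - a $ i) = pi" for i
      using ab[of i] by (auto simp: w_def)
    define s where "s i t = sin (w i * (t - c $ i)) * sin (w i * (e $ i - t))" for i t
    have el: "elementary (\<lambda>x. s i (x $ i))" for i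
      unfolding s_def
      by (intro elementary.mult elementary.sin elementary_minus elementary.const elementary.coord)
    have per: "s i (t + (b $ i - a $ i)) = s i t" for i t
    proof -
      have "w i * (t + (b $ i - a $ i) - c $ i) = w i * (t - c $ i) + pi"
        "w i * (e $ i - (t + (b $ i - a $ i))) = w i * (e $ i - t) - pi"
        using w(2)[of i] by (simp_all add: algebra_simps)
      then show ?thesis unfolding s_def by simp
    qed
    \<comment> \<open>Inside the cell both arguments stay strictly between \<open>-pi\<close> and
      \<open>pi\<close>, so each sine has the sign of its argument. Since
      \<open>c $ i < e $ i\<close>, at most one factor fails to be positive.\<close>
    have pos: "s i t > 0 \<longleftrightarrow> c $ i < t \<and> t < e $ i" if t: "a $ i < t" "t < b $ i" for i t
    proof -
      have lt: "w i * r < pi" if "r < b $ i - a $ i" for r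
        using mult_strict_left_mono[OF that w(1)[of i]] w(2)[of i] by simp
      have gt: "sin (w i * r) > 0" if "0 < r" "r < b $ i - a $ i" for r
        using that w(1)[of i] lt by (intro sin_gt_zero) auto
      have le: "sin (w i * r) \<le> 0" if "r \<le> 0" "- r < b $ i - a $ i" for r
        using gt[of "- r"] that by (cases "r = 0") auto
      consider "c $ i < t" "t < e $ i" | "t \<le> c $ i" | "e $ i \<le> t" by linarith
      then show ?thesis
      proof cases
        case 1
        have "sin (w i * (t - c $ i)) > 0" "sin (w i * (e $ i - t)) > 0"
          using 1 t sub[of i] by (auto intro!: gt)
        then show ?thesis using 1 by (simp add: s_def)
      next
        case 2
        have "sin (w i * (t - c $ i)) \<le> 0" "sin (w i * (e $ i - t)) > 0"
          using 2 t sub[of i] ce[of i] by (auto intro!: gt le)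
        then show ?thesis using 2 by (simp add: s_def zero_less_mult_iff)
      next
        case 3
        have "sin (w i * (t - c $ i)) > 0" "sin (w i * (e $ i - t)) \<le> 0"
          using 3 t sub[of i] ce[of i] by (auto intro!: gt le)
        then show ?thesis using 3 by (simp add: s_def zero_less_mult_iff)
      qed
    qed
    have "bump s n (x + axis j (b $ j - a $ j)) = bump s n x" for n x j
      unfolding bump_def by (rule prod.cong) (auto simp: axis_def per)
    then show ?thesis
      using el bump_smooth[OF el] pos Periodic by (intro exI[of _ s]) (auto simp: mem_box_cart)
  next
    case (Homogeneous U)
    \<comment> \<open>A parabola with zeros \<open>c $ i\<close> and \<open>e $ i\<close> takes the
      place of the sine product.\<close>
    define s where "s i t = (t - c $ i) * (e $ i - t)" for i t
    have el: "elementary (\<lambda>x. s i (x $ i))" for i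
      unfolding s_def by (intro elementary.mult elementary_minus elementary.const elementary.coord)
    have pos: "s i t > 0 \<longleftrightarrow> c $ i < t \<and> t < e $ i" for i t
      using ce[of i] by (auto simp: s_def zero_less_mult_iff)
    have test: "test_function D (bump s n)" for n
    proof -
      \<comment> \<open>The lower bound 1 forces every \<open>s i\<close> to be positive, so
        \<open>K\<close> lies in the open box; the intersection with \<open>cbox c e\<close> makes
        compactness visible.\<close>
      define K where "K = cbox c e \<inter> {x. \<forall>i. 1 \<le> real n * s i (x $ i)}"
      have "closed {x. \<forall>i. 1 \<le> real n * s i (x $ i)}"
        unfolding s_def by (intro closed_Collect_all closed_Collect_le continuous_intros)
      then have "compact K" unfolding K_def by (intro compact_Int_closed) auto
      moreover have in_box: "x \<in> box c e" if "\<forall>i. 1 \<le> real n * s i (x $ i)" for x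
      proof -
        have "s i (x $ i) > 0" for i
        proof (rule ccontr)
          assume "\<not> s i (x $ i) > 0"
          then have "real n * s i (x $ i) \<le> 0" by (simp add: mult_nonneg_nonpos)
          with that show False by (meson not_one_le_zero order_trans)
        qed
        then show ?thesis by (simp add: mem_box_cart pos)
      qed
      then have "K \<subseteq> U" using box Homogeneous by (auto simp: K_def)
      moreover have "bump s n x = 0" if "x \<notin> K" for x
      proof (rule ccontr)
        assume "bump s n x \<noteq> 0"
        then have "\<forall>i. 1 \<le> real n * s i (x $ i)" by (meson bump_nonzero less_imp_le)
        moreover from this have "x \<in> cbox c e" using in_box box_subset_cbox by blast
        ultimately show False using that by (auto simp: K_def)
      qed
      ultimately show ?thesis using bump_smooth[OF el] Homogeneous by auto
    qed
    then show ?thesis using el pos by (intro exI[of _ s]) (auto simp: mem_box_cart)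
  qed
  then obtain s where s: "\<And>n. test_function D (bump s n)"
    "\<And>x. x \<in> region D \<Longrightarrow> (\<forall>i. s i (x $ i) > 0) \<longleftrightarrow> x \<in> box c e" by blast
  show ?thesis
  proof (rule that[of "bump s"])
    show "(\<lambda>n. bump s n x) \<longlonglongrightarrow> indicator (box c e) x" if "x \<in> region D" for x
      using bump_tendsto[of s x] s(2)[OF that] by (auto simp: indicator_def split: if_splits)
  qed (use s bump_bound in auto)
qed

section \<open>Square integrable fields and the weak divergence\<close>

lemma region_open_bounded:
  assumes "valid_dom D"
  shows "open (region D)" "bounded (region D)"
  using assms by (cases D; auto)+

lemma finite_measure_region:
  assumes "valid_dom D"
  shows "finite_measure (lebesgue_on (region D))"
  using region_open_bounded[OF assms]
  by (intro finite_measureI) (auto simp: emeasure_restrict_space dest: emeasure_bounded_finite)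

lemma integrable_inner_L2:
  fixes f g :: "real^2 \<Rightarrow> 'b::euclidean_space"
  assumes "f \<in> L2 D" "g \<in> L2 D"
  shows "integrable (lebesgue_on (region D)) (\<lambda>x. f x \<bullet> g x)"
proof (rule Bochner_Integration.integrable_bound)
  show "integrable (lebesgue_on (region D)) (\<lambda>x. (norm (f x))\<^sup>2 + (norm (g x))\<^sup>2)"
    using assms by (auto simp: L2_def)
  show "(\<lambda>x. f x \<bullet> g x) \<in> borel_measurable (lebesgue_on (region D))"
    using assms by (auto simp: L2_def intro: borel_measurable_inner)
  have "\<bar>y \<bullet> z\<bar> \<le> (norm y)\<^sup>2 + (norm z)\<^sup>2" for y z :: 'b
    using Cauchy_Schwarz_ineq2[of y z] sum_squares_bound[of "norm y" "norm z"]
      mult_nonneg_nonneg[OF norm_ge_zero[of y] norm_ge_zero[of z]] by linarith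
  then show "AE x in lebesgue_on (region D). norm (f x \<bullet> g x) \<le> norm ((norm (f x))\<^sup>2 + (norm (g x))\<^sup>2)"
    by simp
qed

lemma periodic_if_lincomb:
  "periodic_if D f \<Longrightarrow> periodic_if D g \<Longrightarrow> periodic_if D (\<lambda>x. a *\<^sub>R f x + b *\<^sub>R g x)"
  by (cases D) auto

lemma L2_lincomb:
  fixes f g :: "real^2 \<Rightarrow> 'b::euclidean_space"
  assumes "f \<in> L2 D" "g \<in> L2 D"
  shows "(\<lambda>x. a *\<^sub>R f x + b *\<^sub>R g x) \<in> L2 D"
proof -
  let ?M = "lebesgue_on (region D)"
  have "integrable ?M (\<lambda>x. a\<^sup>2 * (f x \<bullet> f x) + 2 * a * b * (f x \<bullet> g x) + b\<^sup>2 * (g x \<bullet> g x))"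
    using assms by (intro Bochner_Integration.integrable_add integrable_mult_right integrable_inner_L2)
  then have "integrable ?M (\<lambda>x. (norm (a *\<^sub>R f x + b *\<^sub>R g x))\<^sup>2)"
    unfolding power2_norm_eq_inner
    by (simp add: inner_add_left inner_add_right inner_commute[of "g _" "f _"]
        power2_eq_square algebra_simps)
  then show ?thesis
    using assms periodic_if_lincomb by (auto simp: L2_def)
qed

text \<open>The product is dominated by the squared norm of \<open>f\<close> plus a constant, and
  constants are integrable on a region of finite measure.\<close>

lemma integrable_inner_bounded_L2:
  fixes f g :: "real^2 \<Rightarrow> 'b::euclidean_space"
  assumes D: "valid_dom D" and f: "f \<in> L2 D"
    and g: "g \<in> borel_measurable (lebesgue_on (region D))" "\<And>x. x \<in> region D \<Longrightarrow> norm (g x) \<le> C"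
  shows "integrable (lebesgue_on (region D)) (\<lambda>x. f x \<bullet> g x)"
proof -
  let ?M = "lebesgue_on (region D)"
  interpret finite_measure ?M using finite_measure_region[OF D] .
  show ?thesis
  proof (rule Bochner_Integration.integrable_bound)
    show "integrable ?M (\<lambda>x. (norm (f x))\<^sup>2 + C\<^sup>2)"
      using f by (auto simp: L2_def)
    show "(\<lambda>x. f x \<bullet> g x) \<in> borel_measurable ?M"
      using f g by (auto simp: L2_def intro: borel_measurable_inner)
    have "\<bar>f x \<bullet> g x\<bar> \<le> (norm (f x))\<^sup>2 + C\<^sup>2" if "x \<in> region D" for x
    proof -
      have "\<bar>f x \<bullet> g x\<bar> \<le> norm (f x) * C"
        using Cauchy_Schwarz_ineq2[of "f x" "g x"] mult_left_mono[OF g(2)[OF that] norm_ge_zero[of "f x"]]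
        by linarith
      moreover have "2 * (norm (f x) * C) \<le> (norm (f x))\<^sup>2 + C\<^sup>2"
        using sum_squares_bound[of "norm (f x)" C] by simp
      moreover have "0 \<le> norm (f x) * C"
        using g(2)[OF that] by (simp add: order_trans[OF norm_ge_zero])
      ultimately show ?thesis by linarith
    qed
    then show "AE x in ?M. norm (f x \<bullet> g x) \<le> norm ((norm (f x))\<^sup>2 + C\<^sup>2)"
      by (intro AE_I2) (auto simp: space_restrict_space)
  qed
qed

lemma smooth_continuous:
  assumes "smooth \<phi>"
  shows "continuous_on A \<phi>" "continuous_on A (partial i \<phi>)"
proof -
  have "times_differentiable 2 \<phi>" using assms by (simp add: smooth_def)
  then have "\<forall>x. \<phi> differentiable (at x)" "\<forall>x. partial i \<phi> differentiable (at x)"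
    by (simp_all add: numeral_2_eq_2)
  then show "continuous_on A \<phi>" "continuous_on A (partial i \<phi>)"
    by (auto intro!: continuous_at_imp_continuous_on differentiable_imp_continuous_within)
qed

lemma test_function_smooth: "test_function D \<phi> \<Longrightarrow> smooth \<phi>"
  by (cases D) auto

text \<open>A continuous function is bounded on the compact closure of the region. This covers test
  functions and their gradients, including periodic ones that do not vanish near the
  boundary.\<close>

lemma integrable_inner_continuous_L2:
  fixes f g :: "real^2 \<Rightarrow> 'b::euclidean_space"
  assumes D: "valid_dom D" and f: "f \<in> L2 D" and g: "continuous_on UNIV g"
  shows "integrable (lebesgue_on (region D)) (\<lambda>x. f x \<bullet> g x)"
proof -
  have "compact (g ` closure (region D))"
    using region_open_bounded[OF D] g
    by (intro compact_continuous_image) (auto intro: continuous_on_subset)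
  then obtain C where C: "\<And>y. y \<in> g ` closure (region D) \<Longrightarrow> norm y \<le> C"
    using compact_imp_bounded bounded_iff by metis
  show ?thesis
  proof (rule integrable_inner_bounded_L2[OF D f])
    show "g \<in> borel_measurable (lebesgue_on (region D))"
      using g by (intro measurable_restrict_space1 measurable_completion) (simp add: borel_measurable_continuous_onI)
    show "norm (g x) \<le> C" if "x \<in> region D" for x
      using that closure_subset by (intro C) blast
  qed
qed

text \<open>The fundamental lemma of the calculus of variations: dominated convergence along the
  bumps, with majorant \<open>\<bar>d x\<bar>\<close>, turns orthogonality to test functions into
  vanishing integrals over boxes.\<close>

lemma AE_zero_if_orthogonal_to_test_functions:
  assumes D: "valid_dom D" and d: "d \<in> L2 D"
    and orth: "\<And>\<phi>. test_function D \<phi> \<Longrightarrow> integ D (\<lambda>x. d x * \<phi> x) = 0"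
  shows "AE x in lebesgue_on (region D). d x = 0"
proof (rule AE_zero_if_box_integrals_zero_on)
  let ?M = "lebesgue_on (region D)"
  show "open (region D)" using region_open_bounded[OF D] by simp
  show int: "integrable ?M d"
    \<comment> \<open>Pairing with the constant 1 gives plain integrability from square
      integrability.\<close>
    using integrable_inner_continuous_L2[OF D d, of "\<lambda>x. 1"] by simp
  then have dm[measurable]: "d \<in> borel_measurable ?M" by auto
  fix a b assume ab: "box a b \<subseteq> region D"
  obtain \<phi> where \<phi>: "\<And>n. test_function D (\<phi> n)" "\<And>n x. \<bar>\<phi> n x\<bar> \<le> 1"
    "\<And>x. x \<in> region D \<Longrightarrow> (\<lambda>n. \<phi> n x) \<longlonglongrightarrow> indicator (box a b) x"
    using test_function_indicator_box[OF D ab] by blast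
  have \<phi>m[measurable]: "\<phi> n \<in> borel_measurable ?M" for n
    using smooth_continuous(1)[OF test_function_smooth[OF \<phi>(1)]]
    by (intro measurable_restrict_space1 measurable_completion) (simp add: borel_measurable_continuous_onI)
  have im[measurable]: "indicator (box a b) \<in> borel_measurable ?M"
    by (intro measurable_restrict_space1 measurable_completion) simp
  have "(\<lambda>n. LINT x|?M. d x * \<phi> n x) \<longlonglongrightarrow> (LINT x|?M. d x * indicator (box a b) x)"
  proof (rule integral_dominated_convergence)
    show "integrable ?M (\<lambda>x. \<bar>d x\<bar>)" using int by simp
    show "AE x in ?M. (\<lambda>n. d x * \<phi> n x) \<longlonglongrightarrow> d x * indicator (box a b) x"
      by (intro AE_I2 tendsto_intros \<phi>(3)) (simp add: space_restrict_space)
    show "AE x in ?M. norm (d x * \<phi> n x) \<le> \<bar>d x\<bar>" for n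
      using \<phi>(2) by (auto simp: abs_mult mult_left_le)
  qed measurable
  moreover have "(LINT x|?M. d x * \<phi> n x) = 0" for n
    using orth[OF \<phi>(1)] by (simp add: integ_def)
  ultimately show "(LINT x|?M. d x * indicator (box a b) x) = 0"
    by (simp add: LIMSEQ_const_iff)
qed

text \<open>\<open>has_weak_div\<close> does not itself place the field in \<open>L2\<close>; the
  assumptions \<open>L\<close> make the integrands integrable, so that the integrals split.\<close>

lemma has_weak_div_lincomb:
  assumes D: "valid_dom D" and L: "v \<in> L2 D" "w \<in> L2 D"
    and v: "has_weak_div D v d" and w: "has_weak_div D w e"
  shows "has_weak_div D (\<lambda>x. a *\<^sub>R v x + b *\<^sub>R w x) (\<lambda>x. a *\<^sub>R d x + b *\<^sub>R e x)"
  unfolding has_weak_div_def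
proof (intro conjI allI impI)
  have de: "d \<in> L2 D" "e \<in> L2 D" using v w by (auto simp: has_weak_div_def)
  then show "(\<lambda>x. a *\<^sub>R d x + b *\<^sub>R e x) \<in> L2 D" by (rule L2_lincomb)
  fix \<phi> assume \<phi>: "test_function D \<phi>"
  note cont = smooth_continuous[OF test_function_smooth[OF \<phi>], where A = UNIV]
  have "continuous_on UNIV (grad \<phi>)"
    using continuous_on_vec_lambda[of UNIV "\<lambda>i. partial i \<phi>"] cont(2) unfolding grad_def by simp
  then have i: "integrable (lebesgue_on (region D)) (\<lambda>x. v x \<bullet> grad \<phi> x)"
    "integrable (lebesgue_on (region D)) (\<lambda>x. w x \<bullet> grad \<phi> x)"
    using integrable_inner_continuous_L2[OF D] L by auto
  have j: "integrable (lebesgue_on (region D)) (\<lambda>x. d x * \<phi> x)"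
    "integrable (lebesgue_on (region D)) (\<lambda>x. e x * \<phi> x)"
    using integrable_inner_continuous_L2[OF D _ cont(1)] de by auto
  have "integ D (\<lambda>x. (a *\<^sub>R v x + b *\<^sub>R w x) \<bullet> grad \<phi> x)
      = a * integ D (\<lambda>x. v x \<bullet> grad \<phi> x) + b * integ D (\<lambda>x. w x \<bullet> grad \<phi> x)"
    using i by (simp add: integ_def inner_add_left)
  also have "\<dots> = - (a * integ D (\<lambda>x. d x * \<phi> x) + b * integ D (\<lambda>x. e x * \<phi> x))"
    using v w \<phi> by (simp add: has_weak_div_def)
  also have "a * integ D (\<lambda>x. d x * \<phi> x) + b * integ D (\<lambda>x. e x * \<phi> x)
      = integ D (\<lambda>x. (a *\<^sub>R d x + b *\<^sub>R e x) * \<phi> x)"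
    using j by (simp add: integ_def distrib_right mult.assoc)
  finally show "integ D (\<lambda>x. (a *\<^sub>R v x + b *\<^sub>R w x) \<bullet> grad \<phi> x)
      = - integ D (\<lambda>x. (a *\<^sub>R d x + b *\<^sub>R e x) * \<phi> x)" .
qed

lemma has_weak_div_unique:
  assumes D: "valid_dom D" and v: "has_weak_div D v d" "has_weak_div D v e"
  shows "AE x in lebesgue_on (region D). d x = e x"
proof -
  have de: "d \<in> L2 D" "e \<in> L2 D" using v by (auto simp: has_weak_div_def)
  have "AE x in lebesgue_on (region D). 1 *\<^sub>R d x + (-1) *\<^sub>R e x = 0"
  proof (rule AE_zero_if_orthogonal_to_test_functions[OF D])
    show "(\<lambda>x. 1 *\<^sub>R d x + (-1) *\<^sub>R e x) \<in> L2 D" using de by (rule L2_lincomb)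
    fix \<phi> assume \<phi>: "test_function D \<phi>"
    have "continuous_on UNIV \<phi>" using smooth_continuous[OF test_function_smooth[OF \<phi>]] by blast
    then have "integrable (lebesgue_on (region D)) (\<lambda>x. d x * \<phi> x)"
      "integrable (lebesgue_on (region D)) (\<lambda>x. e x * \<phi> x)"
      using integrable_inner_continuous_L2[OF D] de by fastforce+
    moreover have "integ D (\<lambda>x. d x * \<phi> x) = integ D (\<lambda>x. e x * \<phi> x)"
      using v \<phi> by (simp add: has_weak_div_def)
    ultimately show "integ D (\<lambda>x. (1 *\<^sub>R d x + (-1) *\<^sub>R e x) * \<phi> x) = 0"
      by (simp add: integ_def left_diff_distrib)
  qed
  then show ?thesis by eventually_elim simp
qed

text \<open>Lets any known weak divergence replace the chosen representative under an integral;
  \<open>d\<close> also witnesses that the choice is a genuine divergence.\<close>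

lemma integ_weak_div:
  assumes D: "valid_dom D" and q: "q \<in> L2 D" and v: "has_weak_div D v d"
  shows "integ D (\<lambda>x. q x * weak_div D v x) = integ D (\<lambda>x. q x * d x)"
proof -
  have w: "has_weak_div D v (weak_div D v)" unfolding weak_div_def by (rule someI[of _ d]) (rule v)
  have "AE x in lebesgue_on (region D). weak_div D v x = d x"
    by (rule has_weak_div_unique[OF D w v])
  then have "AE x in lebesgue_on (region D). q x * weak_div D v x = q x * d x"
    by eventually_elim simp
  then show ?thesis
    unfolding integ_def using q v w
    by (intro integral_cong_AE) (auto simp: L2_def has_weak_div_def)
qed

lemma V1_imp_L2: "v \<in> V1 D \<Longrightarrow> v \<in> L2 D"
  by (cases D) auto

section \<open>Riesz representation in discrete spaces and the discrete gradient\<close>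

definition linear_functional :: "('a \<Rightarrow> 'b::real_vector) set \<Rightarrow> (('a \<Rightarrow> 'b) \<Rightarrow> real) \<Rightarrow> bool" where
  "linear_functional W l \<longleftrightarrow> (\<forall>f\<in>W. \<forall>g\<in>W. \<forall>a b. l (\<lambda>x. a *\<^sub>R f x + b *\<^sub>R g x) = a * l f + b * l g)"

text \<open>Gram-Schmidt by induction on \<open>B\<close>. The form \<open>m\<close> may degenerate,
  as the \<open>L2\<close> product does on functions that vanish almost everywhere;
  \<open>m_null\<close> and the condition on \<open>l\<close> make such directions harmless.\<close>

lemma riesz_finite_spanning:
  fixes m :: "('a \<Rightarrow> 'b::real_vector) \<Rightarrow> ('a \<Rightarrow> 'b) \<Rightarrow> real"
  assumes W: "\<And>f g a b. f \<in> W \<Longrightarrow> g \<in> W \<Longrightarrow> (\<lambda>x. a *\<^sub>R f x + b *\<^sub>R g x) \<in> W"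
    and zero: "(\<lambda>x. 0) \<in> W"
    and m_lin: "\<And>f. f \<in> W \<Longrightarrow> linear_functional W (m f)"
    and m_sym: "\<And>f g. m f g = m g f"
    and m_null: "\<And>f g. f \<in> W \<Longrightarrow> g \<in> W \<Longrightarrow> m g g = 0 \<Longrightarrow> m f g = 0"
    and B: "finite B" "B \<subseteq> W"
    and l: "linear_functional W l" "\<And>g. g \<in> W \<Longrightarrow> m g g = 0 \<Longrightarrow> l g = 0"
  shows "\<exists>w\<in>W. \<forall>b\<in>B. m w b = l b"
proof -
  \<comment> \<open>That every linear functional vanishing on \<open>B\<close> vanishes at \<open>w\<close> says, by duality, that \<open>w\<close> lies
      in the span of \<open>B\<close>.\<close>
  have "\<exists>w\<in>W. (\<forall>b\<in>B. m w b = l b) \<and> (\<forall>k. linear_functional W k \<longrightarrow> (\<forall>b\<in>B. k b = 0) \<longrightarrow> k w = 0)"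
    using B l
  proof (induction B arbitrary: l rule: finite_induct)
    case empty
    have "k (\<lambda>x. 0) = 0" if "linear_functional W k" for k
      using that[unfolded linear_functional_def, rule_format, OF zero zero, of 0 0] by simp
    then show ?case using zero by auto
  next
    case (insert b B)
    have b: "b \<in> W" and BW: "B \<subseteq> W" using insert by auto
    obtain w where w: "w \<in> W" "\<And>c. c \<in> B \<Longrightarrow> m w c = l c"
      and wk: "\<And>k. linear_functional W k \<Longrightarrow> (\<And>c. c \<in> B \<Longrightarrow> k c = 0) \<Longrightarrow> k w = 0"
      using insert.IH[OF BW insert.prems(2,3)] by blast
    \<comment> \<open>The induction hypothesis for the functional \<open>m b\<close>: \<beta> is the
      projection of \<open>b\<close> onto the span of \<open>B\<close>, and \<open>z\<close> below
      is the part of \<open>b\<close> orthogonal to \<open>B\<close>.\<close>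
    obtain \<beta> where \<beta>: "\<beta> \<in> W" "\<And>c. c \<in> B \<Longrightarrow> m \<beta> c = m b c"
      and \<beta>k: "\<And>k. linear_functional W k \<Longrightarrow> (\<And>c. c \<in> B \<Longrightarrow> k c = 0) \<Longrightarrow> k \<beta> = 0"
      using insert.IH[OF BW m_lin[OF b] m_null[OF b]] by blast
    define z where "z = (\<lambda>x. 1 *\<^sub>R b x + (-1) *\<^sub>R \<beta> x)"
    have z: "z \<in> W" unfolding z_def using W b \<beta>(1) .
    have at_z: "k z = k b - k \<beta>" if "linear_functional W k" for k
      using that[unfolded linear_functional_def, rule_format, OF b \<beta>(1), of 1 "-1"] by (simp add: z_def)
    have zB: "m z c = 0" if "c \<in> B" for c
    proof -
      have "m c z = m c b - m c \<beta>" using that BW by (intro at_z m_lin) auto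
      then show ?thesis using \<beta>(2)[OF that] by (simp add: m_sym)
    qed
    have "m z \<beta> = 0" by (rule \<beta>k) (use z zB m_lin in auto)
    then have zz: "m z z = m z b" using at_z[OF m_lin[OF z]] by simp
    show ?case
    proof (cases "m z z = 0")
      case True
      \<comment> \<open>The functional \<open>l - m w\<close> vanishes on \<open>B\<close>, hence at
        \<beta>, and also at the null vector \<open>z\<close>; so it vanishes at \<open>b\<close>,
        and \<open>w\<close> needs no correction.\<close>
      have "linear_functional W (\<lambda>v. l v - m w v)"
        using insert.prems(2) m_lin[OF w(1)] unfolding linear_functional_def by (auto simp: algebra_simps)
      then have "l \<beta> - m w \<beta> = 0" by (rule \<beta>k) (use w in auto)
      moreover have "l z = 0" "m w z = 0" using True z w insert.prems m_null by auto
      ultimately have "m w b = l b"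
        using at_z[OF insert.prems(2)] at_z[OF m_lin[OF w(1)]] by simp
      then show ?thesis using w wk by (intro bexI[of _ w]) auto
    next
      case False
      \<comment> \<open>Adding a multiple of \<open>z\<close> leaves the values on \<open>B\<close>
        unchanged; since \<open>m z b = m z z\<close>, this multiple corrects the value at
        \<open>b\<close>.\<close>
      define t where "t = (l b - m w b) / m z z"
      define w' where "w' = (\<lambda>x. 1 *\<^sub>R w x + t *\<^sub>R z x)"
      have w': "w' \<in> W" unfolding w'_def using W w(1) z .
      have at_w': "k w' = k w + t * k z" if "linear_functional W k" for k
        using that[unfolded linear_functional_def, rule_format, OF w(1) z, of 1 t] by (simp add: w'_def)
      have mw': "m w' c = m w c + t * m z c" if "c \<in> W" for c
        using at_w'[OF m_lin[OF that]] by (simp add: m_sym)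
      have "m w' c = l c" if "c \<in> insert b B" for c
        using that mw'[of c] BW b w zB zz False by (auto simp: t_def)
      moreover have "k w' = 0" if "linear_functional W k" "\<forall>c\<in>insert b B. k c = 0" for k
        using at_w'[OF that(1)] at_z[OF that(1)] wk[OF that(1)] \<beta>k[OF that(1)] that(2) by simp
      ultimately show ?thesis using w' by blast
    qed
  qed
  then show ?thesis by blast
qed

lemma integ_inner_lincomb:
  fixes f g h :: "real^2 \<Rightarrow> 'b::euclidean_space"
  assumes "f \<in> L2 D" "g \<in> L2 D" "h \<in> L2 D"
  shows "integ D (\<lambda>x. f x \<bullet> (a *\<^sub>R g x + b *\<^sub>R h x))
      = a * integ D (\<lambda>x. f x \<bullet> g x) + b * integ D (\<lambda>x. f x \<bullet> h x)"
  using integrable_inner_L2[OF assms(1,2)] integrable_inner_L2[OF assms(1,3)]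
  by (simp add: integ_def inner_add_right)

lemma integ_inner_self_eq_0:
  assumes "f \<in> L2 D" "integ D (\<lambda>x. f x \<bullet> f x) = 0"
  shows "AE x in lebesgue_on (region D). f x = 0"
  using integral_nonneg_eq_0_iff_AE[OF integrable_inner_L2[OF assms(1,1)]] assms(2)
  by (simp add: integ_def)

text \<open>\<open>B\<close> spans only up to null sets. The assumption \<open>null\<close> lets
  \<open>l\<close> descend to classes modulo null sets, so representation on \<open>B\<close>
  extends to all of \<open>W\<close>.\<close>

lemma riesz_discrete_space:
  fixes W :: "(real^2 \<Rightarrow> 'b::euclidean_space) set"
  assumes W: "discrete_space D W" "W \<subseteq> L2 D"
    and lin: "linear_functional W l"
    and null: "\<And>f. f \<in> W \<Longrightarrow> AE x in lebesgue_on (region D). f x = 0 \<Longrightarrow> l f = 0"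
  obtains w where "w \<in> W" "\<And>v. v \<in> W \<Longrightarrow> integ D (\<lambda>x. w x \<bullet> v x) = l v"
proof -
  define m where "m f g = integ D (\<lambda>x. f x \<bullet> g x)" for f g :: "real^2 \<Rightarrow> 'b"
  have zero: "(\<lambda>x. 0) \<in> W" using W by (auto simp: discrete_space_def)
  have comb: "(\<lambda>x. a *\<^sub>R f x + b *\<^sub>R g x) \<in> W" if "f \<in> W" "g \<in> W" for a b f g
    using W(1) that by (simp add: discrete_space_def)
  obtain B where B: "finite B" "B \<subseteq> W" and span:
    "\<And>f. f \<in> W \<Longrightarrow> \<exists>c. AE x in lebesgue_on (region D). f x = (\<Sum>b\<in>B. c b *\<^sub>R b x)"
    using W(1) by (auto simp: discrete_space_def)
  have m_null: "m f g = 0" if "AE x in lebesgue_on (region D). g x = 0" for f g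
    unfolding m_def integ_def using that by (intro integral_eq_zero_AE) auto
  have m_lin: "m f (\<lambda>x. a *\<^sub>R g x + b *\<^sub>R h x) = a * m f g + b * m f h"
    if "f \<in> W" "g \<in> W" "h \<in> W" for f g h a b
    unfolding m_def using that W(2) by (intro integ_inner_lincomb) auto
  have "\<exists>w\<in>W. \<forall>b\<in>B. m w b = l b"
  proof (rule riesz_finite_spanning[of W m B l])
    show "(\<lambda>x. a *\<^sub>R f x + b *\<^sub>R g x) \<in> W" if "f \<in> W" "g \<in> W" for f g a b
      using that by (rule comb)
    show "linear_functional W (m f)" if "f \<in> W" for f
      using m_lin that by (simp add: linear_functional_def)
    show "linear_functional W l" by (rule lin)
    show "m f g = m g f" for f g
      by (simp add: m_def inner_commute)
    show "m f g = 0" if "f \<in> W" "g \<in> W" "m g g = 0" for f g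
      using that W(2) by (intro m_null integ_inner_self_eq_0) (auto simp: m_def)
    show "l g = 0" if "g \<in> W" "m g g = 0" for g
      using that W(2) by (intro null integ_inner_self_eq_0) (auto simp: m_def)
  qed (use zero B in simp_all)
  then obtain w where w: "w \<in> W" "\<And>b. b \<in> B \<Longrightarrow> m w b = l b" by blast
  have "m w v = l v" if v: "v \<in> W" for v
  proof -
    \<comment> \<open>The defect \<open>k\<close> is linear, zero on combinations of
      \<open>B\<close> and zero on null fields; \<open>v\<close> is the sum of such a combination
      \<open>s\<close> and a null field \<open>r\<close>.\<close>
    define k where "k f = m w f - l f" for f
    have k_lin: "k (\<lambda>x. a *\<^sub>R f x + b *\<^sub>R g x) = a * k f + b * k g" if "f \<in> W" "g \<in> W" for f g a b
      using lin m_lin[OF w(1)] that by (simp add: k_def linear_functional_def algebra_simps)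
    obtain c where c: "AE x in lebesgue_on (region D). v x = (\<Sum>b\<in>B. c b *\<^sub>R b x)"
      using span[OF v] by blast
    define s where "s = (\<lambda>x. \<Sum>b\<in>B. c b *\<^sub>R b x)"
    have "(\<lambda>x. \<Sum>b\<in>C. c b *\<^sub>R b x) \<in> W \<and> k (\<lambda>x. \<Sum>b\<in>C. c b *\<^sub>R b x) = 0" if "C \<subseteq> B" for C
      using finite_subset[OF that B(1)] that
    proof (induction C rule: finite_induct)
      case empty
      then show ?case using zero k_lin[OF zero zero, of 0 0] by simp
    next
      case (insert b C)
      then have b: "b \<in> W" "k b = 0" using B w by (auto simp: k_def)
      then show ?case
        using insert comb[OF b(1), of "\<lambda>x. \<Sum>b\<in>C. c b *\<^sub>R b x" "c b" 1]
          k_lin[OF b(1), of "\<lambda>x. \<Sum>b\<in>C. c b *\<^sub>R b x" "c b" 1] by simp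
    qed
    then have s: "s \<in> W" "k s = 0" unfolding s_def by auto
    define r where "r = (\<lambda>x. 1 *\<^sub>R v x + (-1) *\<^sub>R s x)"
    have r: "r \<in> W" unfolding r_def using v s(1) by (rule comb)
    have "AE x in lebesgue_on (region D). r x = 0"
      using c by eventually_elim (simp add: r_def s_def)
    then have "k r = 0" using null[OF r] m_null by (simp add: k_def)
    moreover have "k r = k v - k s" using k_lin[OF v s(1), of 1 "-1"] by (simp add: r_def)
    ultimately show ?thesis using s(2) by (simp add: k_def)
  qed
  with w(1) show ?thesis unfolding m_def by (rule that)
qed

text \<open>Riesz representation shows that the choice in \<open>dual_grad\<close> has a witness.
  The second claim admits any weak divergence \<open>d\<close>, so that the divergence 0 of the
  initial field can be inserted directly.\<close>

lemma dual_grad_properties: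
  assumes D: "valid_dom D" and cx: "discrete_complex D V0h V1h V2h" and q: "q \<in> V2h"
  shows "dual_grad D V1h q \<in> V1h"
    and "\<And>v d. v \<in> V1h \<Longrightarrow> has_weak_div D v d \<Longrightarrow>
      integ D (\<lambda>x. dual_grad D V1h q x \<bullet> v x) = - integ D (\<lambda>x. q x * d x)"
proof -
  have V1: "discrete_space D V1h" "V1h \<subseteq> L2 D"
    and qL: "q \<in> L2 D" and div: "\<And>v. v \<in> V1h \<Longrightarrow> \<exists>d. has_weak_div D v d"
    using cx q V1_imp_L2 unfolding discrete_complex_def V2_def by blast+
  define l where "l v = - integ D (\<lambda>x. q x * weak_div D v x)" for v
  have l: "l v = - integ D (\<lambda>x. q x * d x)" if "has_weak_div D v d" for v d
    using integ_weak_div[OF D qL that] by (simp add: l_def)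
  have "\<exists>w. w \<in> V1h \<and> (\<forall>v\<in>V1h. integ D (\<lambda>x. w x \<bullet> v x) = l v)"
  proof -
    have lin: "l (\<lambda>x. a *\<^sub>R f x + b *\<^sub>R g x) = a * l f + b * l g"
      if fg: "f \<in> V1h" "g \<in> V1h" for f g a b
    proof -
      obtain d e where d: "has_weak_div D f d" and e: "has_weak_div D g e"
        using div fg by blast
      then have de: "d \<in> L2 D" "e \<in> L2 D" by (auto simp: has_weak_div_def)
      have "has_weak_div D (\<lambda>x. a *\<^sub>R f x + b *\<^sub>R g x) (\<lambda>x. a *\<^sub>R d x + b *\<^sub>R e x)"
        using V1(2) fg d e by (intro has_weak_div_lincomb[OF D]) auto
      from l[OF this] l[OF d] l[OF e] integ_inner_lincomb[OF qL de, of a b] show ?thesis by simp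
    qed
    have null: "l f = 0" if f: "f \<in> V1h" "AE x in lebesgue_on (region D). f x = 0" for f
    proof -
      \<comment> \<open>A null field has 0 as a weak divergence, because its pairing with every
        gradient vanishes.\<close>
      have "integ D (\<lambda>x. f x \<bullet> h x) = 0" for h
        unfolding integ_def using f(2) by (intro integral_eq_zero_AE) auto
      moreover have "(\<lambda>x. 0 :: real) \<in> L2 D"
        using L2_lincomb[OF qL qL, of 0 0] by simp
      ultimately have "has_weak_div D f (\<lambda>x. 0)"
        by (simp add: has_weak_div_def) (simp add: integ_def)
      from l[OF this] show ?thesis by (simp add: integ_def)
    qed
    obtain w where "w \<in> V1h" "\<And>v. v \<in> V1h \<Longrightarrow> integ D (\<lambda>x. w x \<bullet> v x) = l v"
      using riesz_discrete_space[OF V1, of l] lin null unfolding linear_functional_def by blast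
    then show ?thesis by blast
  qed
  from someI_ex[OF this]
  have w: "dual_grad D V1h q \<in> V1h"
    "\<And>v. v \<in> V1h \<Longrightarrow> integ D (\<lambda>x. dual_grad D V1h q x \<bullet> v x) = l v"
    unfolding dual_grad_def l_def by blast+
  show "dual_grad D V1h q \<in> V1h" by (rule w)
  show "integ D (\<lambda>x. dual_grad D V1h q x \<bullet> v x) = - integ D (\<lambda>x. q x * d x)"
    if "v \<in> V1h" "has_weak_div D v d" for v d
    using w(2)[OF that(1)] l[OF that(2)] by simp
qed

section \<open>The transport term and the energy balance\<close>

text \<open>For equal arguments the sum cancels pointwise, whichever representatives were chosen,
  leaving the projection of the zero field. Its chosen representative is known only to be orthogonal
  to \<open>V1h\<close>, which suffices since \<open>u\<close> lies there.\<close>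

lemma integ_inner_s_h_self:
  assumes "discrete_space D V1h" "u \<in> V1h"
  shows "integ D (\<lambda>x. u x \<bullet> s_h D V1h V2h u u x) = 0"
proof -
  define w where "w = L2_proj D V1h (\<lambda>y. 0)"
  have "\<exists>w. w \<in> V1h \<and> (\<forall>z\<in>V1h. integ D (\<lambda>x. (0 - w x) \<bullet> z x) = 0)"
    using assms(1) by (intro exI[of _ "\<lambda>x. 0"]) (auto simp: discrete_space_def integ_def)
  from someI_ex[OF this] have "integ D (\<lambda>x. (0 - w x) \<bullet> u x) = 0"
    using assms(2) unfolding w_def L2_proj_def by blast
  then have "integ D (\<lambda>x. u x \<bullet> w x) = 0"
    by (simp add: integ_def inner_commute)
  then show ?thesis
    by (simp add: s_h_def w_def[symmetric] integ_def)
qed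

theorem proposition12:
  fixes D :: dom
    and V0h :: "scalar_field set" and V1h :: "vector_field set" and V2h :: "scalar_field set"
    and \<Delta>t :: real
    and u :: "nat \<Rightarrow> vector_field" and p :: "nat \<Rightarrow> scalar_field"
  assumes "valid_dom D"
    and "discrete_complex D V0h V1h V2h"
    and "\<Delta>t > 0"
    and "\<And>n. u n \<in> V1h"
    and "has_weak_div D (u 0) (\<lambda>x. 0)"
    and "\<And>n. n \<ge> 1 \<Longrightarrow> p n \<in> V2h"
    and "\<And>n. crank_nicolson_step D V1h V2h \<Delta>t u p n"
  shows "\<forall>n. (1/\<Delta>t) * (integ D (\<lambda>x. (1/2) * (norm (u (Suc n) x))\<^sup>2)
                    - integ D (\<lambda>x. (1/2) * (norm (u n x))\<^sup>2)) = 0"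
proof
  fix n
  let ?G = "dual_grad D V1h"
  note G = dual_grad_properties[OF assms(1,2)]
  have V1: "discrete_space D V1h" "V1h \<subseteq> L2 D"
    using assms(2) V1_imp_L2 unfolding discrete_complex_def by blast+
  have uL: "u n \<in> L2 D" for n using assms(4) V1 by blast
  have momentum: "integ D (\<lambda>x. ((1/\<Delta>t) *\<^sub>R (u (Suc n) x - u n x)) \<bullet> v x)
        + integ D (\<lambda>x. midpoint_field u n x \<bullet> s_h D V1h V2h (midpoint_field u n) v x)
        + integ D (\<lambda>x. ?G (p (Suc n)) x \<bullet> v x) = 0" if "v \<in> V1h" for n v
    using assms(7)[of n] that unfolding crank_nicolson_step_def by blast
  have pressure: "integ D (\<lambda>x. midpoint_field u n x \<bullet> s_h D V1h V2h (midpoint_field u n) (?G q) x)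
        + integ D (\<lambda>x. ?G (p (Suc n)) x \<bullet> ?G q x) = 0" if "q \<in> V2h" for n q
    using assms(7)[of n] that unfolding crank_nicolson_step_def by blast
  have diff: "integ D (\<lambda>x. ((1/\<Delta>t) *\<^sub>R (u (Suc n) x - u n x)) \<bullet> v x)
      = (1/\<Delta>t) * (integ D (\<lambda>x. u (Suc n) x \<bullet> v x) - integ D (\<lambda>x. u n x \<bullet> v x))"
    if "v \<in> V1h" for n v
    using integ_inner_lincomb[OF _ uL uL, of v "1/\<Delta>t" "Suc n" "- (1/\<Delta>t)" n] that V1(2)
    by (auto simp: scaleR_diff_right inner_commute right_diff_distrib)
  \<comment> \<open>Weak incompressibility, in exactly the form in which the velocity meets the
    pressure term.\<close>
  have div_free: "integ D (\<lambda>x. u n x \<bullet> ?G q x) = 0" if q: "q \<in> V2h" for n q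
  proof (induction n)
    case 0
    show ?case using G(2)[OF q assms(4,5)] by (simp add: integ_def inner_commute)
  next
    case (Suc n)
    have "(1/\<Delta>t) * (integ D (\<lambda>x. u (Suc n) x \<bullet> ?G q x) - integ D (\<lambda>x. u n x \<bullet> ?G q x)) = 0"
      using momentum[OF G(1)[OF q], of n] pressure[OF q, of n] diff[OF G(1)[OF q], of n] by linarith
    then show ?case using Suc assms(3) by simp
  qed
  have mid_eq: "midpoint_field u n = (\<lambda>x. (1/2) *\<^sub>R u (Suc n) x + (1/2) *\<^sub>R u n x)"
    by (auto simp: midpoint_field_def scaleR_add_right)
  have mid: "midpoint_field u n \<in> V1h"
    unfolding mid_eq using V1(1) assms(4) by (simp add: discrete_space_def)
  have mid_inner: "integ D (\<lambda>x. f x \<bullet> midpoint_field u n x)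
      = (1/2) * integ D (\<lambda>x. f x \<bullet> u (Suc n) x) + (1/2) * integ D (\<lambda>x. f x \<bullet> u n x)"
    if "f \<in> L2 D" for f
    unfolding mid_eq by (rule integ_inner_lincomb[OF that uL uL])
  have p: "p (Suc n) \<in> V2h" using assms(6) by simp
  then have "?G (p (Suc n)) \<in> L2 D" using G(1) V1(2) by blast
  then have "integ D (\<lambda>x. ?G (p (Suc n)) x \<bullet> midpoint_field u n x) = 0"
    using mid_inner div_free[OF p] by (subst mid_inner) (simp_all add: inner_commute[of "?G (p (Suc n)) _"])
  then have "(1/\<Delta>t) * (integ D (\<lambda>x. u (Suc n) x \<bullet> midpoint_field u n x)
      - integ D (\<lambda>x. u n x \<bullet> midpoint_field u n x)) = 0"
    using momentum[OF mid, of n] integ_inner_s_h_self[OF V1(1) mid, of V2h] diff[OF mid, of n]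
    by linarith
  \<comment> \<open>The difference of squares: the mixed terms cancel by symmetry of the inner
    product.\<close>
  moreover have "integ D (\<lambda>x. u (Suc n) x \<bullet> midpoint_field u n x)
      - integ D (\<lambda>x. u n x \<bullet> midpoint_field u n x)
      = integ D (\<lambda>x. (1/2) * (norm (u (Suc n) x))\<^sup>2) - integ D (\<lambda>x. (1/2) * (norm (u n x))\<^sup>2)"
    using mid_inner[OF uL] inner_commute
    by (simp add: integ_def power2_norm_eq_inner inner_commute[of "u n _" "u (Suc n) _"])
  ultimately show "(1/\<Delta>t) * (integ D (\<lambda>x. (1/2) * (norm (u (Suc n) x))\<^sup>2)
                    - integ D (\<lambda>x. (1/2) * (norm (u n x))\<^sup>2)) = 0" by simp
qed

end
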